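(* Let $H\in\mathbb{R}^{n\times n}$ be symmetric and let $c\in\mathbb{R}^n$, $c\neq 0$. Let $\theta_0,\dots,\theta_{r-1}$ be arbitrary nonzero real numbers, let $(q_k,y_k,\delta_k)$, $k=0,\dots,r$, be the unnormalized Lanczos triples generated from $H$, $c$ and the $\theta_k$ (defined in the context), and for $k=0,\dots,r$ let $x_k^{MR}$ be a solution to $\min_{x\in\mathcal{K}_k(c,H)}\|Hx+c\|_2^2$. If $\delta_0^{MR}=\delta_0^2$, $y_0^{MR}=\delta_0y_0$, and $$\delta_k^{MR}=q_k^Tq_k\sum_{i=0}^{k-1}\frac{\delta_i^2}{q_i^Tq_i}+\delta_k^2\quad\text{and}\quad y_k^{MR}=q_k^Tq_k\sum_{i=0}^{k-1}\frac{\delta_i}{q_i^Tq_i}y_i+\delta_ky_k,\quad k=1,\dots,r,$$ then $$x_k^{MR}=\frac{1}{\delta_k^{MR}}y_k^{MR},\quad k=0,\dots,r-1,\quad\text{and also for } k=r\text{ if }\delta_r\neq 0.$$ In addition, it holds that $$\delta_{k+1}^{MR}=\frac{q_{k+1}^Tq_{k+1}}{q_k^Tq_k}\delta_k^{MR}+\delta_{k+1}^2\quad\text{and}\quad y_{k+1}^{MR}=\frac{q_{k+1}^Tq_{k+1}}{q_k^Tq_k}y_k^{MR}+\delta_{k+1}y_{k+1},$$ for $k=0,\dots,r-1$.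
   Context: All arithmetic is exact and norms are Euclidean. Krylov subspaces: $\mathcal{K}_0(c,H)=\{0\}$ and $\mathcal{K}_k(c,H)=\mathrm{span}\{c,Hc,\dots,H^{k-1}c\}$ for $k\geq 1$. $r$ denotes the smallest positive integer $k$ for which $\mathcal{K}_{k+1}(c,H)=\mathcal{K}_k(c,H)$. Unnormalized Lanczos triples: given nonzero reals $\theta_0,\dots,\theta_{r-1}$, set $(q_0,y_0,\delta_0)=(c,0,1)$, $$q_1=\theta_0(-Hq_0+\alpha_0q_0),\quad y_1=\theta_0(-q_0+\alpha_0y_0),\quad \delta_1=\theta_0\alpha_0\delta_0,$$ and for $k=1,\dots,r-1$, $$q_{k+1}=\theta_k(-Hq_k+\alpha_kq_k+\beta_{k-1}q_{k-1}),\quad y_{k+1}=\theta_k(-q_k+\alpha_ky_k+\beta_{k-1}y_{k-1}),\quad \delta_{k+1}=\theta_k(\alpha_k\delta_k+\beta_{k-1}\delta_{k-1}),$$ where $\alpha_k=\frac{q_k^THq_k}{q_k^Tq_k}$ for $k=0,\dots,r-1$ and $\beta_{k-1}=\frac{q_{k-1}^THq_k}{q_{k-1}^Tq_{k-1}}$ for $k=1,\dots,r-1$. These are well defined, with $q_k\in\mathcal{K}_{k+1}(c,H)\cap\mathcal{K}_k(c,H)^\perp$, $y_k\in\mathcal{K}_k(c,H)$ and $q_k=Hy_k+\delta_kc$; moreover $q_k\neq 0$ for $k<r$, $q_r=0$, and $y_1,\dots,y_r$ are linearly independent. *)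

theory Defs
  imports "HOL-Analysis.Analysis"
begin

text \<open>For \<open>k = 0\<close> this is \<open>span {} = {0}\<close>.\<close>

definition krylov :: "nat \<Rightarrow> real ^ 'n \<Rightarrow> real ^ 'n ^ 'n \<Rightarrow> (real ^ 'n) set" where
  "krylov k c H = span ((\<lambda>i. (((*v) H) ^^ i) c) ` {..<k})"

definition krylov_index :: "real ^ 'n \<Rightarrow> real ^ 'n ^ 'n \<Rightarrow> nat" where
  "krylov_index c H = (LEAST k. 0 < k \<and> krylov (k + 1) c H = krylov k c H)"

text \<open>
  The coefficients \<open>\<alpha>\<^sub>k\<close> and \<open>\<beta>\<^sub>k\<close> of a sequence of vectors \<open>q\<close>:
  note that \<open>\<beta>\<^sub>k\<close> involves both \<open>q\<^sub>k\<close> and \<open>q\<^sub>k\<^sub>+\<^sub>1\<close>.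
\<close>

definition lanczos_alpha :: "real ^ 'n ^ 'n \<Rightarrow> real ^ 'n \<Rightarrow> real" where
  "lanczos_alpha H q = (q \<bullet> (H *v q)) / (q \<bullet> q)"

definition lanczos_beta :: "real ^ 'n ^ 'n \<Rightarrow> real ^ 'n \<Rightarrow> real ^ 'n \<Rightarrow> real" where
  "lanczos_beta H p q = (p \<bullet> (H *v q)) / (p \<bullet> p)"

text \<open>
  The recursions below are total, but only the indices \<open>k \<le> krylov_index c H\<close> are meaningful:
  for symmetric \<open>H\<close> and nonzero \<open>\<theta>\<^sub>k\<close>, \<open>q\<^sub>k\<close> vanishes at that index,
  so that \<open>\<alpha>\<^sub>k\<close> becomes a quotient by zero.
\<close>

fun lanczos_q :: "real ^ 'n ^ 'n \<Rightarrow> real ^ 'n \<Rightarrow> (nat \<Rightarrow> real) \<Rightarrow> nat \<Rightarrow> real ^ 'n" where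
  "lanczos_q H c \<theta> 0 = c"
| "lanczos_q H c \<theta> (Suc 0) =
     \<theta> 0 *\<^sub>R (- (H *v lanczos_q H c \<theta> 0)
       + lanczos_alpha H (lanczos_q H c \<theta> 0) *\<^sub>R lanczos_q H c \<theta> 0)"
| "lanczos_q H c \<theta> (Suc (Suc k)) =
     \<theta> (Suc k) *\<^sub>R (- (H *v lanczos_q H c \<theta> (Suc k))
       + lanczos_alpha H (lanczos_q H c \<theta> (Suc k)) *\<^sub>R lanczos_q H c \<theta> (Suc k)
       + lanczos_beta H (lanczos_q H c \<theta> k) (lanczos_q H c \<theta> (Suc k)) *\<^sub>R lanczos_q H c \<theta> k)"

fun lanczos_y :: "real ^ 'n ^ 'n \<Rightarrow> real ^ 'n \<Rightarrow> (nat \<Rightarrow> real) \<Rightarrow> nat \<Rightarrow> real ^ 'n" where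
  "lanczos_y H c \<theta> 0 = 0"
| "lanczos_y H c \<theta> (Suc 0) =
     \<theta> 0 *\<^sub>R (- lanczos_q H c \<theta> 0
       + lanczos_alpha H (lanczos_q H c \<theta> 0) *\<^sub>R lanczos_y H c \<theta> 0)"
| "lanczos_y H c \<theta> (Suc (Suc k)) =
     \<theta> (Suc k) *\<^sub>R (- lanczos_q H c \<theta> (Suc k)
       + lanczos_alpha H (lanczos_q H c \<theta> (Suc k)) *\<^sub>R lanczos_y H c \<theta> (Suc k)
       + lanczos_beta H (lanczos_q H c \<theta> k) (lanczos_q H c \<theta> (Suc k)) *\<^sub>R lanczos_y H c \<theta> k)"

fun lanczos_delta :: "real ^ 'n ^ 'n \<Rightarrow> real ^ 'n \<Rightarrow> (nat \<Rightarrow> real) \<Rightarrow> nat \<Rightarrow> real" where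
  "lanczos_delta H c \<theta> 0 = 1"
| "lanczos_delta H c \<theta> (Suc 0) =
     \<theta> 0 * (lanczos_alpha H (lanczos_q H c \<theta> 0) * lanczos_delta H c \<theta> 0)"
| "lanczos_delta H c \<theta> (Suc (Suc k)) =
     \<theta> (Suc k) * (lanczos_alpha H (lanczos_q H c \<theta> (Suc k)) * lanczos_delta H c \<theta> (Suc k)
       + lanczos_beta H (lanczos_q H c \<theta> k) (lanczos_q H c \<theta> (Suc k)) * lanczos_delta H c \<theta> k)"

end

theory Submission
  imports Defs
begin

text \<open>
  Every triple satisfies \<open>q\<^sub>k = H y\<^sub>k + \<delta>\<^sub>k c\<close>, and for symmetric \<open>H\<close> and \<open>k \<le> r\<close> the vectors
  \<open>q\<^sub>0, \<dots>, q\<^sub>k\<^sub>-\<^sub>1\<close> form an orthogonal basis of the Krylov space \<open>K\<^sub>k\<close>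
  (\<open>krylov_eq_span_q\<close>, \<open>q_orthogonal\<close>, \<open>q_nonzero\<close>), of which \<open>y\<^sub>1, \<dots>, y\<^sub>k\<close> is another basis
  (\<open>krylov_eq_span_y\<close>).  Since \<open>H y\<^sub>j = q\<^sub>j - \<delta>\<^sub>j c\<close>, a residual \<open>g\<close> is orthogonal to
  \<open>H K\<^sub>k\<close>, which is the optimality condition of the least-squares problem, exactly when
  \<open>q\<^sub>j \<bullet> g = \<delta>\<^sub>j (c \<bullet> g)\<close> for \<open>j = 1, \<dots>, k\<close>.
  For \<open>k < r\<close> this determines \<open>g \<in> K\<^sub>k\<^sub>+\<^sub>1\<close> up to a factor: it is a multiple of
  \<open>\<Sum>i\<le>k. (\<delta>\<^sub>i / (q\<^sub>i \<bullet> q\<^sub>i)) q\<^sub>i\<close>.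

  Replacing each \<open>q\<^sub>i\<close> in this sum by \<open>H y\<^sub>i + \<delta>\<^sub>i c\<close> and multiplying by \<open>q\<^sub>k \<bullet> q\<^sub>k\<close> gives
  \<open>H y\<^sub>k\<^sup>M\<^sup>R + \<delta>\<^sub>k\<^sup>M\<^sup>R c\<close>, so that \<open>y\<^sub>k\<^sup>M\<^sup>R / \<delta>\<^sub>k\<^sup>M\<^sup>R\<close> has a residual of the required form.
  The factor \<open>q\<^sub>k \<bullet> q\<^sub>k\<close> keeps the expression meaningful at \<open>k = r\<close>, where \<open>q\<^sub>r = 0\<close>: there,
  if \<open>\<delta>\<^sub>r \<noteq> 0\<close>, the vector is \<open>y\<^sub>r / \<delta>\<^sub>r\<close> and its residual is zero.  Finally \<open>H\<close> is injective on the Krylov space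
  in both cases (\<open>H_inj_on_krylov\<close>, \<open>H_inj_on_krylov_index\<close>), so the minimizer is unique and
  the given \<open>x\<^sub>k\<^sup>M\<^sup>R\<close> must be this vector.
\<close>

section \<open>Linear least squares and spans\<close>

text \<open>
  By Pythagoras, \<open>\<parallel>H x + c\<parallel>\<^sup>2 = \<parallel>H x' + c\<parallel>\<^sup>2 + \<parallel>H (x - x')\<parallel>\<^sup>2\<close> when the residual of \<open>x'\<close> is
  orthogonal to \<open>H S\<close>; hence a minimizer \<open>x\<close> has \<open>H (x - x') = 0\<close>.
\<close>

lemma least_squares_minimizer_unique:
  fixes H :: "real ^ 'n ^ 'm"
  assumes S: "subspace S"
    and x: "is_arg_min (\<lambda>x. (norm (H *v x + c))\<^sup>2) (\<lambda>x. x \<in> S) x"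
    and x': "x' \<in> S"
    and orth: "\<And>w. w \<in> S \<Longrightarrow> (H *v x' + c) \<bullet> (H *v w) = 0"
    and inj: "\<And>z. z \<in> S \<Longrightarrow> H *v z = 0 \<Longrightarrow> z = 0"
  shows "x = x'"
proof -
  have xS: "x \<in> S" and le: "(norm (H *v x + c))\<^sup>2 \<le> (norm (H *v x' + c))\<^sup>2"
    using x x' by (auto simp: is_arg_min_def not_less)
  have d: "x - x' \<in> S"
    using S xS x' by (rule subspace_diff)
  have split: "H *v x + c = (H *v x' + c) + H *v (x - x')"
    by (simp add: matrix_vector_mult_diff_distrib)
  have "(norm (H *v x + c))\<^sup>2 = (norm (H *v x' + c))\<^sup>2 + (norm (H *v (x - x')))\<^sup>2"
    unfolding split using orth[OF d] by (intro norm_add_Pythagorean) (simp add: orthogonal_def)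
  with le have "H *v (x - x') = 0"
    by simp
  with inj[OF d] show ?thesis
    by simp
qed

lemma span_insert_triangular:
  fixes x y :: "'a::real_vector"
  assumes "s \<noteq> 0" and "x - s *\<^sub>R y \<in> span S"
  shows "span (insert x S) = span (insert y S)"
proof (rule span_eq[THEN iffD2], intro conjI insert_subsetI)
  have d: "x - s *\<^sub>R y \<in> span (insert a S)" for a
    using assms(2) span_mono[of S "insert a S"] by blast
  have "(x - s *\<^sub>R y) + s *\<^sub>R y \<in> span (insert y S)"
    by (intro span_add[OF d] span_scale span_base) simp
  then show "x \<in> span (insert y S)" by simp
  have "(1 / s) *\<^sub>R (x - (x - s *\<^sub>R y)) \<in> span (insert x S)"
    by (intro span_scale span_diff[OF _ d] span_base) simp
  then show "y \<in> span (insert x S)" using assms(1) by simp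
qed (auto intro: span_base)

text \<open>A triangular change of generators with nonzero diagonal preserves the whole flag of spans.\<close>

lemma span_image_triangular:
  fixes u v :: "nat \<Rightarrow> 'a::real_vector"
  assumes "\<And>k. k < n \<Longrightarrow> \<exists>s. s \<noteq> 0 \<and> u k - s *\<^sub>R v k \<in> span (v ` {..<k})"
  shows "span (u ` {..<n}) = span (v ` {..<n})"
  using assms
proof (induction n)
  case (Suc n)
  then have IH: "span (u ` {..<n}) = span (v ` {..<n})"
    by simp
  obtain s where s: "s \<noteq> 0" "u n - s *\<^sub>R v n \<in> span (v ` {..<n})"
    using Suc.prems[of n] by auto
  have "span (u ` {..<Suc n}) = span (insert (u n) (v ` {..<n}))"
    unfolding lessThan_Suc image_insert span_insert IH ..
  also have "\<dots> = span (v ` {..<Suc n})"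
    using span_insert_triangular[OF s] by (simp add: lessThan_Suc)
  finally show ?case .
qed simp

section \<open>Krylov subspaces\<close>

lemma subspace_krylov: "subspace (krylov k c H)"
  by (simp add: krylov_def)

lemma krylov_mono: "j \<le> k \<Longrightarrow> krylov j c H \<subseteq> krylov k c H"
  unfolding krylov_def by (intro span_mono image_mono) auto

lemma krylov_power: "i < k \<Longrightarrow> (((*v) H) ^^ i) c \<in> krylov k c H"
  unfolding krylov_def by (rule span_base) auto

lemma mult_krylov:
  assumes "x \<in> krylov k c H"
  shows "H *v x \<in> krylov (Suc k) c H"
proof -
  have "H *v x \<in> (*v) H ` span ((\<lambda>i. (((*v) H) ^^ i) c) ` {..<k})"
    using assms by (auto simp: krylov_def)
  also have "\<dots> = span ((*v) H ` (\<lambda>i. (((*v) H) ^^ i) c) ` {..<k})"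
    by (rule linear_span_image[symmetric]) simp
  also have "\<dots> \<subseteq> krylov (Suc k) c H"
    unfolding krylov_def
  proof (intro span_mono subsetI)
    fix v assume "v \<in> (*v) H ` (\<lambda>i. (((*v) H) ^^ i) c) ` {..<k}"
    then obtain i where "i < k" "v = H *v (((*v) H) ^^ i) c" by auto
    then show "v \<in> (\<lambda>i. (((*v) H) ^^ i) c) ` {..<Suc k}"
      by (intro image_eqI[of _ _ "Suc i"]) auto
  qed
  finally show ?thesis .
qed

text \<open>The flag of Krylov spaces cannot grow for ever, as its dimensions are bounded.\<close>

lemma krylov_stagnates:
  fixes H :: "real ^ 'n ^ 'n"
  shows "\<exists>k>0. krylov (k + 1) c H = krylov k c H"
proof (rule ccontr)
  assume no: "\<not> ?thesis"
  have "k \<le> dim (krylov (Suc k) c H)" for k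
  proof (induction k)
    case (Suc k)
    have "\<not> dim (krylov (Suc (Suc k)) c H) \<le> dim (krylov (Suc k) c H)"
    proof
      assume "dim (krylov (Suc (Suc k)) c H) \<le> dim (krylov (Suc k) c H)"
      then have "krylov (Suc k) c H = krylov (Suc (Suc k)) c H"
        by (intro subspace_dim_equal subspace_krylov krylov_mono) simp_all
      with no show False by fastforce
    qed
    with Suc.IH show ?case by linarith
  qed simp
  from this[of "Suc DIM(real ^ 'n)"] show False
    using dim_subset_UNIV[of "krylov (Suc (Suc DIM(real ^ 'n))) c H"] by linarith
qed

lemma krylov_index_eq: "krylov (Suc (krylov_index c H)) c H = krylov (krylov_index c H) c H"
  using LeastI_ex[OF krylov_stagnates[of c H]] by (auto simp: krylov_index_def)

lemma krylov_less_index: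
  assumes "0 < k" "k < krylov_index c H"
  shows "krylov (Suc k) c H \<noteq> krylov k c H"
  using not_less_Least[of k "\<lambda>k. 0 < k \<and> krylov (k + 1) c H = krylov k c H"] assms
  by (auto simp: krylov_index_def)

section \<open>The Lanczos triples\<close>

locale lanczos_process =
  fixes H :: "real ^ 'n ^ 'n" and c :: "real ^ 'n" and \<theta> :: "nat \<Rightarrow> real"
  assumes symH: "transpose H = H"
    and c_nonzero: "c \<noteq> 0"
    and theta_nonzero: "k < krylov_index c H \<Longrightarrow> \<theta> k \<noteq> 0"
begin

abbreviation "r \<equiv> krylov_index c H"
abbreviation "K k \<equiv> krylov k c H"
abbreviation "q \<equiv> lanczos_q H c \<theta>"
abbreviation "y \<equiv> lanczos_y H c \<theta>"
abbreviation "\<delta> \<equiv> lanczos_delta H c \<theta>"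

lemma inner_mult_commute: "a \<bullet> (H *v b) = (H *v a) \<bullet> b"
  by (metis dot_lmul_matrix symH transpose_matrix_vector)

lemma q_eq: "q k = H *v y k + \<delta> k *\<^sub>R c"
proof (induction k rule: lanczos_q.induct[of "\<lambda>_ _ _. (\<lambda>k. q k = H *v y k + \<delta> k *\<^sub>R c)" H c \<theta>])
  case (3 _ _ _ k)
  have "q (Suc (Suc k)) = \<theta> (Suc k) *\<^sub>R (- (H *v q (Suc k))
      + lanczos_alpha H (q (Suc k)) *\<^sub>R (H *v y (Suc k) + \<delta> (Suc k) *\<^sub>R c)
      + lanczos_beta H (q k) (q (Suc k)) *\<^sub>R (H *v y k + \<delta> k *\<^sub>R c))"
    by (simp add: 3[symmetric])
  also have "\<dots> = H *v y (Suc (Suc k)) + \<delta> (Suc (Suc k)) *\<^sub>R c"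
    by (simp add: algebra_simps matrix_vector_right_distrib matrix_vector_mult_diff_distrib
        matrix_vector_mult_scaleR)
  finally show ?case .
qed (simp_all add: algebra_simps matrix_vector_mult_scaleR linear_neg[OF matrix_vector_mul_linear])

text \<open>
  The step from \<open>q\<^sub>k\<close> to \<open>q\<^sub>k\<^sub>+\<^sub>1\<close> multiplies the leading term by \<open>- \<theta>\<^sub>k H\<close>, so the coefficient of
  \<open>H\<^sup>k c\<close> in \<open>q\<^sub>k\<close> is \<open>\<plusminus>\<theta>\<^sub>0 \<cdots> \<theta>\<^sub>k\<^sub>-\<^sub>1\<close>.
\<close>

lemma q_leading_coefficient:
  assumes "k \<le> r"
  shows "\<exists>s. s \<noteq> 0 \<and> q k - s *\<^sub>R (((*v) H) ^^ k) c \<in> K k"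
  using assms
proof (induction k rule: less_induct)
  case (less k)
  have q_in: "q j \<in> K k" if j: "j < k" for j
  proof -
    obtain s where "q j - s *\<^sub>R (((*v) H) ^^ j) c \<in> K j"
      using less.IH[of j] less.prems j by auto
    then have "q j - s *\<^sub>R (((*v) H) ^^ j) c \<in> K k"
      using krylov_mono[of j k] j by auto
    then have "(q j - s *\<^sub>R (((*v) H) ^^ j) c) + s *\<^sub>R (((*v) H) ^^ j) c \<in> K k"
      using j by (intro subspace_add subspace_scale subspace_krylov krylov_power)
    then show ?thesis by simp
  qed
  show ?case
  proof (cases k)
    case 0
    then show ?thesis
      by (intro exI[of _ 1]) (simp add: krylov_def)
  next
    case (Suc m)
    obtain s where s: "s \<noteq> 0" "q m - s *\<^sub>R (((*v) H) ^^ m) c \<in> K m"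
      using less.IH[of m] less.prems Suc by auto
    let ?w = "q k + \<theta> m *\<^sub>R (H *v q m)"
    have "?w \<in> K k"
    proof (cases m)
      case 0
      have "?w = (\<theta> m * lanczos_alpha H (q m)) *\<^sub>R q m"
        using Suc 0 by (simp add: algebra_simps)
      then show ?thesis
        using q_in[of m] Suc by (simp add: subspace_scale subspace_krylov)
    next
      case (Suc i)
      have "?w = (\<theta> m * lanczos_alpha H (q m)) *\<^sub>R q m
          + (\<theta> m * lanczos_beta H (q i) (q m)) *\<^sub>R q i"
        using \<open>k = Suc m\<close> Suc by (simp add: algebra_simps)
      then show ?thesis
        using q_in[of m] q_in[of i] \<open>k = Suc m\<close> Suc
        by (simp add: subspace_scale subspace_krylov subspace_add)
    qed
    moreover have "H *v (q m - s *\<^sub>R (((*v) H) ^^ m) c) \<in> K k"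
      using mult_krylov[OF s(2)] Suc by simp
    ultimately have "?w - \<theta> m *\<^sub>R (H *v (q m - s *\<^sub>R (((*v) H) ^^ m) c)) \<in> K k"
      by (intro subspace_diff subspace_scale subspace_krylov)
    also have "?w - \<theta> m *\<^sub>R (H *v (q m - s *\<^sub>R (((*v) H) ^^ m) c))
        = q k - (- \<theta> m * s) *\<^sub>R (((*v) H) ^^ k) c"
      using Suc
      by (simp add: algebra_simps matrix_vector_mult_diff_distrib matrix_vector_mult_scaleR)
    finally show ?thesis
      using s(1) theta_nonzero[of m] less.prems Suc by (intro exI[of _ "- \<theta> m * s"]) auto
  qed
qed

text \<open>
  The bound is \<open>r + 1\<close>, not \<open>r\<close>: the last case puts \<open>q\<^sub>r\<close> into \<open>K\<^sub>r\<^sub>+\<^sub>1 = K\<^sub>r\<close>, to which it is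
  also orthogonal, so that it vanishes.
\<close>

lemma krylov_eq_span_q: "k \<le> Suc r \<Longrightarrow> K k = span (q ` {..<k})"
  unfolding krylov_def
  by (rule span_image_triangular[symmetric], rule q_leading_coefficient[unfolded krylov_def]) auto

lemma q_in_krylov: "j < k \<Longrightarrow> k \<le> Suc r \<Longrightarrow> q j \<in> K k"
  by (auto simp: krylov_eq_span_q intro: span_base)

text \<open>The recurrence for \<open>y\<^sub>k\<^sub>+\<^sub>1\<close>, solved for \<open>q\<^sub>k\<close>, is a triangular change of generators.\<close>

lemma krylov_eq_span_y:
  assumes "k \<le> r"
  shows "K k = span ((\<lambda>i. y (Suc i)) ` {..<k})"
proof -
  let ?Y = "\<lambda>k. (\<lambda>i. y (Suc i)) ` {..<k}"
  have y_in: "y j \<in> span (?Y k)" if "j \<le> k" for j k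
    using that by (cases j) (auto intro: span_base span_zero)
  have "span (q ` {..<k}) = span (?Y k)"
  proof (rule span_image_triangular)
    fix j assume "j < k"
    then have \<theta>: "\<theta> j \<noteq> 0"
      using assms by (intro theta_nonzero) simp
    have "q j - (- 1 / \<theta> j) *\<^sub>R y (Suc j) \<in> span (?Y j)"
    proof (cases j)
      case 0
      have "q j - (- 1 / \<theta> j) *\<^sub>R y (Suc j) = 0"
        using \<theta> 0 by (simp add: algebra_simps)
      then show ?thesis by (simp add: span_zero)
    next
      case (Suc i)
      have "q j - (- 1 / \<theta> j) *\<^sub>R y (Suc j)
          = lanczos_alpha H (q j) *\<^sub>R y j + lanczos_beta H (q i) (q j) *\<^sub>R y i"
        using \<theta> Suc by (simp add: algebra_simps)
      also have "\<dots> \<in> span (?Y j)"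
        using Suc by (intro span_add span_scale y_in) auto
      finally show ?thesis .
    qed
    then show "\<exists>s. s \<noteq> 0 \<and> q j - s *\<^sub>R y (Suc j) \<in> span (?Y j)"
      using \<theta> by (intro exI[of _ "- 1 / \<theta> j"]) simp
  qed
  then show ?thesis
    using krylov_eq_span_q[of k] assms by simp
qed

lemma y_in_krylov: "j \<le> k \<Longrightarrow> k \<le> r \<Longrightarrow> y j \<in> K k"
  by (cases j) (auto simp: krylov_eq_span_y intro: span_base span_zero)

text \<open>
  If \<open>q\<^sub>k\<close> vanished for some \<open>0 < k < r\<close>, adjoining it to the span would not enlarge \<open>K\<^sub>k\<close>,
  contradicting the minimality of \<open>r\<close>.
\<close>

lemma q_nonzero:
  assumes "k < r"
  shows "q k \<noteq> 0"
proof
  assume 0: "q k = 0"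
  then have k: "0 < k"
    using c_nonzero by (cases k) auto
  have "K (Suc k) = span (q ` {..<Suc k})"
    using assms by (simp add: krylov_eq_span_q)
  also have "\<dots> = K k"
    using assms by (simp add: krylov_eq_span_q lessThan_Suc 0 span_insert_0)
  finally show False
    using krylov_less_index[OF k assms] by simp
qed

text \<open>
  Orthogonality to \<open>q\<^sub>k\<close> and \<open>q\<^sub>k\<^sub>-\<^sub>1\<close> is enforced by the choice of \<open>\<alpha>\<close> and \<open>\<beta>\<close>; for earlier
  \<open>q\<^sub>j\<close> it is inherited through the symmetry of \<open>H\<close>, as \<open>H q\<^sub>j\<close> lies in \<open>K\<^sub>j\<^sub>+\<^sub>2 \<subseteq> K\<^sub>k\<close>.
\<close>

lemma q_orthogonal_krylov:
  assumes "k \<le> r" "x \<in> K k"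
  shows "q k \<bullet> x = 0"
  using assms
proof (induction k arbitrary: x rule: less_induct)
  case (less k)
  have base: "q k \<bullet> q j = 0" if j: "j < k" for j
  proof -
    obtain m where m: "k = Suc m" using j by (cases k) auto
    have orth: "q m \<bullet> w = 0" if "w \<in> K m" for w
      using less.IH[of m w] less.prems(1) m that by simp
    have nz: "q i \<noteq> 0" if "i \<le> m" for i
      using that less.prems(1) m by (intro q_nonzero) simp
    show ?thesis
    proof (cases m)
      case 0
      then show ?thesis
        using m j nz[of 0] by (simp add: inner_simps lanczos_alpha_def inner_commute)
    next
      case (Suc i)
      have prev: "q m \<bullet> q i = 0"
        using less.prems(1) m Suc by (intro orth q_in_krylov) auto
      have rec: "q k \<bullet> v = \<theta> m * (- (q m \<bullet> (H *v v)) + lanczos_alpha H (q m) * (q m \<bullet> v)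
          + lanczos_beta H (q i) (q m) * (q i \<bullet> v))" for v
        using m Suc by (simp add: inner_simps inner_mult_commute)
      consider "j = m" | "j = i" | "j < i"
        using j m Suc by linarith
      then show ?thesis
      proof cases
        case 1
        have "lanczos_alpha H (q m) * (q m \<bullet> q m) = q m \<bullet> (H *v q m)"
          using nz[of m] by (simp add: lanczos_alpha_def)
        then show ?thesis
          using prev 1 rec[of "q m"] by (simp add: inner_commute)
      next
        case 2
        have "lanczos_beta H (q i) (q m) * (q i \<bullet> q i) = q i \<bullet> (H *v q m)"
          using nz[of i] Suc by (simp add: lanczos_beta_def)
        also have "\<dots> = q m \<bullet> (H *v q i)"
          using inner_mult_commute[of "q i" "q m"] by (simp add: inner_commute)
        finally show ?thesis
          using prev 2 rec[of "q i"] by simp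
      next
        case 3
        have "q j \<in> K i"
          using 3 less.prems(1) m Suc by (intro q_in_krylov) auto
        then have "q m \<bullet> (H *v q j) = 0" "q m \<bullet> q j = 0"
          using orth mult_krylov[of "q j" i c H] krylov_mono[of i m c H] Suc by auto
        moreover have "q i \<bullet> q j = 0"
          using less.IH[of i "q j"] \<open>q j \<in> K i\<close> less.prems(1) m Suc by simp
        ultimately show ?thesis
          using rec[of "q j"] by simp
      qed
    qed
  qed
  have "orthogonal (q k) x"
  proof (rule orthogonal_to_span)
    show "x \<in> span (q ` {..<k})"
      using less.prems krylov_eq_span_q[of k] by simp
  qed (auto simp: orthogonal_def base)
  then show ?case by (simp add: orthogonal_def)
qed

lemma q_orthogonal: "i \<noteq> j \<Longrightarrow> i \<le> r \<Longrightarrow> j \<le> r \<Longrightarrow> q i \<bullet> q j = 0"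
proof (induction i j rule: linorder_wlog)
  case (le i j)
  then show ?case
    using q_orthogonal_krylov[of j "q i"] q_in_krylov[of i j] by (simp add: inner_commute)
next
  case (sym i j)
  then show ?case by (simp add: inner_commute)
qed

lemma q_index: "q r = 0"
  using q_orthogonal_krylov[of r "q r"] q_in_krylov[of r "Suc r"] by (simp add: krylov_index_eq)

section \<open>Uniqueness of the minimizer\<close>

text \<open>
  Write \<open>z = z' + a y\<^sub>k\<close> with \<open>z' \<in> K\<^sub>k\<^sub>-\<^sub>1\<close>.  Of \<open>H z\<close>, only the part \<open>a q\<^sub>k\<close> of \<open>a H y\<^sub>k\<close> is seen by
  the inner product with \<open>q\<^sub>k\<close>, so \<open>H z = 0\<close> forces \<open>a = 0\<close>.
\<close>

lemma H_inj_on_krylov: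
  assumes "k < r" "z \<in> K k" "H *v z = 0"
  shows "z = 0"
  using assms
proof (induction k)
  case 0
  then show ?case by (simp add: krylov_def)
next
  case (Suc k)
  obtain a where a: "z - a *\<^sub>R y (Suc k) \<in> K k"
    using Suc.prems by (auto simp: krylov_eq_span_y lessThan_Suc span_insert)
  have "q (Suc k) \<bullet> (H *v (z - a *\<^sub>R y (Suc k))) = 0"
    using Suc.prems(1) by (intro q_orthogonal_krylov mult_krylov a) simp
  then have "a * (q (Suc k) \<bullet> (H *v y (Suc k))) = 0"
    using Suc.prems(3)
    by (simp add: matrix_vector_mult_diff_distrib matrix_vector_mult_scaleR)
  also have "H *v y (Suc k) = q (Suc k) - \<delta> (Suc k) *\<^sub>R q 0"
    using q_eq[of "Suc k"] by simp
  also have "q (Suc k) \<bullet> (q (Suc k) - \<delta> (Suc k) *\<^sub>R q 0) = q (Suc k) \<bullet> q (Suc k)"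
    using q_orthogonal[of "Suc k" 0] Suc.prems(1) by (simp add: inner_diff_right del: lanczos_q.simps)
  finally have "a = 0"
    using q_nonzero[OF Suc.prems(1)] by simp
  with a Suc show ?case by simp
qed

text \<open>
  If \<open>\<delta>\<^sub>r \<noteq> 0\<close> then \<open>q\<^sub>r = 0\<close> says that \<open>c\<close>, hence all of \<open>K\<^sub>r\<close>, lies in the range of \<open>H\<close>, to which
  the kernel of the symmetric matrix \<open>H\<close> is orthogonal.
\<close>

lemma H_inj_on_krylov_index:
  assumes "\<delta> r \<noteq> 0" "z \<in> K r" "H *v z = 0"
  shows "z = 0"
proof -
  have range: "z \<bullet> (H *v w) = 0" for w
    using assms(3) by (simp add: inner_mult_commute)
  have "\<delta> r * (z \<bullet> c) = z \<bullet> (q r - H *v y r)"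
    by (simp add: q_eq[of r])
  also have "\<dots> = 0"
    by (simp add: q_index range inner_diff_right)
  finally have "z \<bullet> c = 0"
    using assms(1) by simp
  then have "z \<bullet> (((*v) H) ^^ i) c = 0" for i
    by (cases i) (auto simp: range)
  then have "orthogonal z z"
    using assms(2) unfolding krylov_def
    by (intro orthogonal_to_span[of z]) (auto simp: orthogonal_def)
  then show ?thesis by (simp add: orthogonal_def)
qed

section \<open>The minimum-residual iterates\<close>

text \<open>At \<open>k = 0\<close> the sum is empty, which yields the separately prescribed initial value \<open>\<delta>\<^sub>0\<^sup>2\<close>.\<close>

definition delta_MR :: "nat \<Rightarrow> real" where
  "delta_MR k = (q k \<bullet> q k) * (\<Sum>i<k. (\<delta> i)\<^sup>2 / (q i \<bullet> q i)) + (\<delta> k)\<^sup>2"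

definition y_MR :: "nat \<Rightarrow> real ^ 'n" where
  "y_MR k = (q k \<bullet> q k) *\<^sub>R (\<Sum>i<k. (\<delta> i / (q i \<bullet> q i)) *\<^sub>R y i) + \<delta> k *\<^sub>R y k"

lemma y_MR_in_krylov: "k \<le> r \<Longrightarrow> y_MR k \<in> K k"
  unfolding y_MR_def
  by (intro subspace_add subspace_scale subspace_sum subspace_krylov y_in_krylov) auto

text \<open>
  The residual of \<open>y\<^sup>M\<^sup>R / \<delta>\<^sup>M\<^sup>R\<close>, cleared of its denominator: each \<open>q\<^sub>i\<close> splits as
  \<open>H y\<^sub>i + \<delta>\<^sub>i c\<close>.
\<close>

lemma residual_MR:
  "H *v y_MR k + delta_MR k *\<^sub>R c
    = (q k \<bullet> q k) *\<^sub>R (\<Sum>i<k. (\<delta> i / (q i \<bullet> q i)) *\<^sub>R q i) + \<delta> k *\<^sub>R q k"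
proof -
  have "(\<Sum>i<k. (\<delta> i / (q i \<bullet> q i)) *\<^sub>R q i)
      = (\<Sum>i<k. (\<delta> i / (q i \<bullet> q i)) *\<^sub>R (H *v y i) + ((\<delta> i)\<^sup>2 / (q i \<bullet> q i)) *\<^sub>R c)"
    by (intro sum.cong refl) (simp add: q_eq scaleR_add_right power2_eq_square)
  also have "\<dots> = H *v (\<Sum>i<k. (\<delta> i / (q i \<bullet> q i)) *\<^sub>R y i)
      + (\<Sum>i<k. (\<delta> i)\<^sup>2 / (q i \<bullet> q i)) *\<^sub>R c"
    by (simp add: sum.distrib scaleR_sum_left linear_sum[OF matrix_vector_mul_linear]
        matrix_vector_mult_scaleR)
  finally have S: "(\<Sum>i<k. (\<delta> i / (q i \<bullet> q i)) *\<^sub>R q i) = \<dots>" .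
  have "\<delta> k *\<^sub>R q k = H *v (\<delta> k *\<^sub>R y k) + (\<delta> k)\<^sup>2 *\<^sub>R c"
    by (simp add: q_eq[of k] scaleR_add_right power2_eq_square matrix_vector_mult_scaleR)
  with S show ?thesis
    unfolding y_MR_def delta_MR_def
    by (simp add: algebra_simps matrix_vector_right_distrib matrix_vector_mult_scaleR)
qed

text \<open>
  The scaled residual has inner product \<open>(q\<^sub>k \<bullet> q\<^sub>k) \<delta>\<^sub>j\<close> with every \<open>q\<^sub>j\<close>, \<open>j \<le> k\<close>; these cancel in
  \<open>H y\<^sub>j = q\<^sub>j - \<delta>\<^sub>j q\<^sub>0\<close>, because \<open>\<delta>\<^sub>0 = 1\<close>.
\<close>

lemma residual_MR_orthogonal:
  assumes k: "k \<le> r" and w: "w \<in> K k"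
  shows "(H *v y_MR k + delta_MR k *\<^sub>R c) \<bullet> (H *v w) = 0"
proof -
  let ?g = "H *v y_MR k + delta_MR k *\<^sub>R c"
  have gq: "?g \<bullet> q j = (q k \<bullet> q k) * \<delta> j" if j: "j \<le> k" for j
  proof (cases "j = k")
    case True
    have "(\<Sum>i<k. (\<delta> i / (q i \<bullet> q i)) * (q i \<bullet> q j)) = 0"
      using k True by (intro sum.neutral) (auto simp: q_orthogonal)
    then show ?thesis
      using True unfolding residual_MR by (simp add: inner_simps inner_sum_left)
  next
    case False
    have "(\<Sum>i<k. (\<delta> i / (q i \<bullet> q i)) * (q i \<bullet> q j))
        = (\<Sum>i<k. if i = j then \<delta> j else 0)"
      using k j False q_nonzero[of j] by (intro sum.cong) (auto simp: q_orthogonal)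
    also have "\<dots> = \<delta> j"
      using j False by simp
    finally have "(\<Sum>i<k. (\<delta> i / (q i \<bullet> q i)) * (q i \<bullet> q j)) = \<delta> j" .
    then show ?thesis
      using False j k unfolding residual_MR
      by (simp add: inner_simps inner_sum_left q_orthogonal)
  qed
  have gy: "?g \<bullet> (H *v y j) = 0" if "j \<le> k" for j
  proof -
    have "H *v y j = q j - \<delta> j *\<^sub>R q 0"
      using q_eq[of j] by simp
    then show ?thesis
      using gq[OF that] gq[of 0] by (simp add: inner_diff_right del: lanczos_q.simps)
  qed
  have "orthogonal (H *v ?g) w"
  proof (rule orthogonal_to_span)
    show "w \<in> span ((\<lambda>i. y (Suc i)) ` {..<k})"
      using w krylov_eq_span_y[OF k] by simp
    fix v assume "v \<in> (\<lambda>i. y (Suc i)) ` {..<k}"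
    then obtain i where "i < k" "v = y (Suc i)" by auto
    then show "orthogonal (H *v ?g) v"
      using gy[of "Suc i"] by (simp only: orthogonal_def inner_mult_commute Suc_le_eq)
  qed
  then show ?thesis
    by (simp only: orthogonal_def inner_mult_commute)
qed

text \<open>
  For \<open>0 < k < r\<close> the term \<open>i = 0\<close> makes the sum positive; at \<open>k = 0\<close>, where the sum is empty, and at
  \<open>k = r\<close>, where \<open>q\<^sub>r = 0\<close>, only \<open>\<delta>\<^sub>k\<^sup>2\<close> is left.
\<close>

lemma delta_MR_nonzero:
  assumes "k < r \<or> k = r \<and> \<delta> r \<noteq> 0"
  shows "delta_MR k \<noteq> 0"
proof (cases "k < r \<and> 0 < k")
  case True
  have "0 < (\<delta> 0)\<^sup>2 / (q 0 \<bullet> q 0)"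
    using c_nonzero by simp
  also have "\<dots> \<le> (\<Sum>i<k. (\<delta> i)\<^sup>2 / (q i \<bullet> q i))"
    using True by (intro member_le_sum) auto
  finally show ?thesis
    using True q_nonzero[of k] unfolding delta_MR_def
    by (intro less_imp_neq[symmetric] add_pos_nonneg mult_pos_pos) auto
next
  case False
  then show ?thesis
    using assms by (cases "k = 0") (auto simp: delta_MR_def q_index)
qed

lemma minimizer_eq_MR:
  assumes k: "k < r \<or> k = r \<and> \<delta> r \<noteq> 0"
    and x: "is_arg_min (\<lambda>x. (norm (H *v x + c))\<^sup>2) (\<lambda>x. x \<in> K k) x"
  shows "x = (1 / delta_MR k) *\<^sub>R y_MR k"
proof (rule least_squares_minimizer_unique[OF subspace_krylov x])
  show "(1 / delta_MR k) *\<^sub>R y_MR k \<in> K k"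
    using k by (intro subspace_scale subspace_krylov y_MR_in_krylov) auto
next
  fix w assume w: "w \<in> K k"
  have "H *v ((1 / delta_MR k) *\<^sub>R y_MR k) + c
      = (1 / delta_MR k) *\<^sub>R (H *v y_MR k + delta_MR k *\<^sub>R c)"
    using delta_MR_nonzero[OF k] by (simp add: scaleR_add_right matrix_vector_mult_scaleR)
  then show "(H *v ((1 / delta_MR k) *\<^sub>R y_MR k) + c) \<bullet> (H *v w) = 0"
    using residual_MR_orthogonal[OF _ w] k by auto
next
  fix z assume "z \<in> K k" "H *v z = 0"
  then show "z = 0"
    using k H_inj_on_krylov H_inj_on_krylov_index by blast
qed

lemma delta_MR_Suc:
  assumes "k < r"
  shows "delta_MR (Suc k) = (q (Suc k) \<bullet> q (Suc k)) / (q k \<bullet> q k) * delta_MR k + (\<delta> (Suc k))\<^sup>2"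
proof -
  have "q k \<bullet> q k \<noteq> 0"
    using q_nonzero[OF assms] by simp
  then show ?thesis
    unfolding delta_MR_def by (simp add: field_simps del: lanczos_q.simps lanczos_delta.simps inner_eq_zero_iff)
qed

lemma y_MR_Suc:
  assumes "k < r"
  shows "y_MR (Suc k) = ((q (Suc k) \<bullet> q (Suc k)) / (q k \<bullet> q k)) *\<^sub>R y_MR k
    + \<delta> (Suc k) *\<^sub>R y (Suc k)"
proof -
  have "q k \<bullet> q k \<noteq> 0"
    using q_nonzero[OF assms] by simp
  then show ?thesis
    unfolding y_MR_def
    by (simp add: scaleR_add_right del: lanczos_q.simps lanczos_delta.simps lanczos_y.simps inner_eq_zero_iff)
qed

end

theorem corollary4p1:
  fixes H :: "real ^ 'n ^ 'n" and c :: "real ^ 'n"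
    and \<theta> \<delta> \<delta>MR :: "nat \<Rightarrow> real" and q y yMR xMR :: "nat \<Rightarrow> real ^ 'n" and r :: nat
  defines "r \<equiv> krylov_index c H"
    and "q \<equiv> lanczos_q H c \<theta>" and "y \<equiv> lanczos_y H c \<theta>" and "\<delta> \<equiv> lanczos_delta H c \<theta>"
  assumes symH: "transpose H = H"
    and c_nz: "c \<noteq> 0"
    and theta_nz: "\<And>k. k < r \<Longrightarrow> \<theta> k \<noteq> 0"
    and xMR: "\<And>k. k \<le> r \<Longrightarrow>
      is_arg_min (\<lambda>x. (norm (H *v x + c))\<^sup>2) (\<lambda>x. x \<in> krylov k c H) (xMR k)"
    and deltaMR_0: "\<delta>MR 0 = (\<delta> 0)\<^sup>2"
    and yMR_0: "yMR 0 = \<delta> 0 *\<^sub>R y 0"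
    and deltaMR: "\<And>k. 1 \<le> k \<Longrightarrow> k \<le> r \<Longrightarrow>
      \<delta>MR k = (q k \<bullet> q k) * (\<Sum>i<k. (\<delta> i)\<^sup>2 / (q i \<bullet> q i)) + (\<delta> k)\<^sup>2"
    and yMR: "\<And>k. 1 \<le> k \<Longrightarrow> k \<le> r \<Longrightarrow>
      yMR k = (q k \<bullet> q k) *\<^sub>R (\<Sum>i<k. (\<delta> i / (q i \<bullet> q i)) *\<^sub>R y i) + \<delta> k *\<^sub>R y k"
  shows "(\<forall>k. k < r \<or> (k = r \<and> \<delta> r \<noteq> 0) \<longrightarrow>
            \<delta>MR k \<noteq> 0 \<and> xMR k = (1 / \<delta>MR k) *\<^sub>R yMR k) \<and>
         (\<forall>k<r.
            \<delta>MR (k + 1) = (q (k + 1) \<bullet> q (k + 1)) / (q k \<bullet> q k) * \<delta>MR k + (\<delta> (k + 1))\<^sup>2 \<and>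
            yMR (k + 1) = ((q (k + 1) \<bullet> q (k + 1)) / (q k \<bullet> q k)) *\<^sub>R yMR k
              + \<delta> (k + 1) *\<^sub>R y (k + 1))"
proof -
  interpret L: lanczos_process H c \<theta>
    using symH c_nz theta_nz by unfold_locales (auto simp: r_def)
  have \<delta>MR: "\<delta>MR k = L.delta_MR k" if "k \<le> r" for k
    using that deltaMR_0 deltaMR[of k]
    by (cases "k = 0") (auto simp: L.delta_MR_def q_def \<delta>_def)
  have yMR': "yMR k = L.y_MR k" if "k \<le> r" for k
    using that yMR_0 yMR[of k]
    by (cases "k = 0") (auto simp: L.y_MR_def q_def y_def \<delta>_def)
  show ?thesis
  proof (intro conjI allI impI)
    fix k assume k: "k < r \<or> k = r \<and> \<delta> r \<noteq> 0"
    then have kr: "k \<le> r" by auto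
    have k': "k < krylov_index c H
        \<or> k = krylov_index c H \<and> lanczos_delta H c \<theta> (krylov_index c H) \<noteq> 0"
      using k by (simp add: r_def \<delta>_def)
    show "\<delta>MR k \<noteq> 0"
      using L.delta_MR_nonzero[OF k'] \<delta>MR[OF kr] by simp
    show "xMR k = (1 / \<delta>MR k) *\<^sub>R yMR k"
      using L.minimizer_eq_MR[OF k' xMR[OF kr]] \<delta>MR[OF kr] yMR'[OF kr] by simp
  next
    fix k assume k: "k < r"
    show "\<delta>MR (k + 1) = (q (k + 1) \<bullet> q (k + 1)) / (q k \<bullet> q k) * \<delta>MR k + (\<delta> (k + 1))\<^sup>2"
      using L.delta_MR_Suc[of k] k \<delta>MR[of k] \<delta>MR[of "Suc k"] by (simp add: r_def q_def \<delta>_def)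
    show "yMR (k + 1) = ((q (k + 1) \<bullet> q (k + 1)) / (q k \<bullet> q k)) *\<^sub>R yMR k
        + \<delta> (k + 1) *\<^sub>R y (k + 1)"
      using L.y_MR_Suc[of k] k yMR'[of k] yMR'[of "Suc k"] by (simp add: r_def q_def y_def \<delta>_def)
  qed
qed

end
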